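(* Let $\mathscr{L}$ be a countable relational language and $\mathbf{K}$ an $\mathscr{L}$-age. Suppose that: $\mathbf{K}$ has the hereditary property and the $3$-disjoint amalgamation property; for all $\mathcal{A}\in\mathbf{K}$ with $|A|>2$, $\mathbf{K}$ is indivisible at $\mathcal{A}$; and $\beta$ is a bound on indivisibility for $\mathbf{K}$. For $\mathcal{A}\in\mathbf{K}$ define $\gamma_{\mathcal{A}}$ on the positive integers by $\gamma_{\mathcal{A}}(1)=|A|$ and $$\gamma_{\mathcal{A}}(n+1)=\beta\big(\gamma_{\mathcal{A}}(n),(n+1)\cdot|A|\big)^{\leq |A|}.$$ Then for all $\mathcal{A}\in\mathbf{K}$ and all integers $n\geq 1$ there is a $\mathcal{B}\in\mathbf{K}$ with $|B|\leq\gamma_{\mathcal{A}}(n)$ such that $\mathcal{B}$ witnesses the $n$-sunflower property of $\mathbf{K}$ at $\mathcal{A}$.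
   Context: All relation symbols have finite arity. Script letters denote structures, Roman letters their underlying sets; $[n]=\{0,\dots,n-1\}$; $\mathcal{A}\restriction_{B}$ is the substructure of $\mathcal{A}$ with underlying set $B$. An $\mathscr{L}$-age is a collection of finite $\mathscr{L}$-structures closed under isomorphism. Here $m^{\leq k}$ denotes the number of sequences of length at most $k$ from an $m$-element set, i.e. $\sum_{i=0}^{k}m^i$; conventions: $\infty^{\leq k}=\infty$, $\beta(\infty,k)=\infty$, and every natural number is $\leq\infty$. $\mathbf{K}$ has the hereditary property if $\mathcal{A}\in\mathbf{K}$ and $A_0\subseteq A$ imply $\mathcal{A}\restriction_{A_0}\in\mathbf{K}$. $\mathbf{K}$ has the $3$-disjoint amalgamation property if whenever $\mathcal{A}_0,\mathcal{A}_1,\mathcal{A}_2\in\mathbf{K}$ satisfy $\mathcal{A}_i\restriction_{A_i\cap A_j}=\mathcal{A}_j\restriction_{A_i\cap A_j}$ for all $i,j\in[3]$, there is $\mathcal{B}\in\mathbf{K}$ with $\mathcal{B}\restriction_{A_i}=\mathcal{A}_i$ for all $i\in[3]$. For $\mathcal{A}\in\mathbf{K}$ and $n\in\omega$, $\mathcal{B}\in\mathbf{K}$ is a witness to indivisibility of $\mathcal{A}$ in $\mathbf{K}$ of order $n$ if for every map $\alpha:B\to[n+1]$ there is $\mathcal{A}^+\subseteq\mathcal{B}$ with $\mathcal{A}^+\cong\mathcal{A}$ and $|\alpha[A^+]|=1$. $\mathbf{K}$ is indivisible at $\mathcal{A}$ if for all $n$ such a witness exists. A function $\beta:\omega\times\omega\to\omega\cup\{\infty\}$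 is a bound on indivisibility for $\mathbf{K}$ if it is non-decreasing in its first coordinate and for all $\mathcal{A}\in\mathbf{K}$ and $n\in\omega$ either $\mathbf{K}$ is not indivisible at $\mathcal{A}$ and $\beta(|A|,n)=\infty$, or there is $\mathcal{B}\in\mathbf{K}$ with $|B|\leq\beta(|A|,n)$ which is a witness to indivisibility of $\mathcal{A}$ in $\mathbf{K}$ of order $n$. A set $Y$ of finite sets is a sunflower if there is a set $r$ such that $p\cap q=r$ for all distinct $p,q\in Y$. $\mathcal{B}\in\mathbf{K}$ witnesses the $n$-sunflower property of $\mathbf{K}$ at $\mathcal{A}\in\mathbf{K}$ if whenever $\mathcal{B}'\cong\mathcal{B}$ and all elements of $B'$ are sets of size $n$, there is a substructure $\mathcal{A}'\subseteq\mathcal{B}'$ with $\mathcal{A}'\cong\mathcal{A}$ and $A'$ a sunflower. *)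

theory Defs
  imports
    Main
    "HOL-Library.Countable_Set"
    "HOL-Library.FuncSet"
    "HOL-Library.Extended_Nat"
    "HOL-Library.Infinite_Typeclass"
begin

section \<open>Relational structures\<close>

text \<open>
  A relational language is a set \<open>L\<close> of relation symbols with an arity function \<open>ar\<close>
  (nullary symbols are allowed). An \<open>L\<close>-structure has its underlying set inside a type; symbols
  outside \<open>L\<close> are interpreted by the empty relation, so that equality of structures, as used in
  the amalgamation property below, is HOL equality.
\<close>

record ('r, 'a) struct =
  carrier :: "'a set"
  rel :: "'r \<Rightarrow> 'a list set"

definition is_struct :: "'r set \<Rightarrow> ('r \<Rightarrow> nat) \<Rightarrow> ('r, 'a) struct \<Rightarrow> bool" where
  "is_struct L ar A \<longleftrightarrow>
     (\<forall>R\<in>L. rel A R \<subseteq> {xs. length xs = ar R \<and> set xs \<subseteq> carrier A}) \<and>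
     (\<forall>R. R \<notin> L \<longrightarrow> rel A R = {})"

text \<open>
  The two structures may live over different types. For \<open>L\<close>-structures, quantifying over all
  \<open>R\<close> and all lists over the carrier is the same as quantifying over \<open>R \<in> L\<close> and lists of
  length \<open>ar R\<close>.
\<close>

definition iso :: "('r, 'a) struct \<Rightarrow> ('r, 'b) struct \<Rightarrow> bool" (infix "\<cong>" 50) where
  "A \<cong> B \<longleftrightarrow> (\<exists>f. bij_betw f (carrier A) (carrier B) \<and>
     (\<forall>R. \<forall>xs\<in>lists (carrier A). map f xs \<in> rel B R \<longleftrightarrow> xs \<in> rel A R))"

text \<open>
  The carrier is cut down to \<open>carrier A \<inter> X\<close>, so an equation \<open>restr B (carrier A) = A\<close>
  includes \<open>carrier A \<subseteq> carrier B\<close>.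
\<close>

definition restr :: "('r, 'a) struct \<Rightarrow> 'a set \<Rightarrow> ('r, 'a) struct" where
  "restr A X = \<lparr>carrier = carrier A \<inter> X, rel = (\<lambda>R. rel A R \<inter> lists X)\<rparr>"

definition substruct :: "('r, 'a) struct \<Rightarrow> ('r, 'a) struct \<Rightarrow> bool" where
  "substruct A B \<longleftrightarrow> carrier A \<subseteq> carrier B \<and> A = restr B (carrier A)"

section \<open>Ages\<close>

text \<open>
  The type \<open>'a\<close> is the universe from which the elements of the members of \<open>K\<close> are drawn. It is
  infinite, so every finite structure has an isomorphic copy over \<open>'a\<close> and amalgams never lack
  room for new points.
\<close>

definition age ::
  "'r set \<Rightarrow> ('r \<Rightarrow> nat) \<Rightarrow> ('r, 'a::infinite) struct set \<Rightarrow> bool" where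
  "age L ar K \<longleftrightarrow>
     (\<forall>A\<in>K. is_struct L ar A \<and> finite (carrier A)) \<and>
     (\<forall>A\<in>K. \<forall>B. is_struct L ar B \<and> A \<cong> B \<longrightarrow> B \<in> K)"

definition hereditary :: "('r, 'a) struct set \<Rightarrow> bool" where
  "hereditary K \<longleftrightarrow> (\<forall>A\<in>K. \<forall>X. X \<subseteq> carrier A \<longrightarrow> restr A X \<in> K)"

definition disjoint_amalgamation_3 :: "('r, 'a) struct set \<Rightarrow> bool" where
  "disjoint_amalgamation_3 K \<longleftrightarrow>
     (\<forall>A :: nat \<Rightarrow> ('r, 'a) struct.
        (\<forall>i<3. A i \<in> K) \<and>
        (\<forall>i<3. \<forall>j<3. restr (A i) (carrier (A i) \<inter> carrier (A j)) =
                       restr (A j) (carrier (A i) \<inter> carrier (A j)))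
        \<longrightarrow> (\<exists>B\<in>K. \<forall>i<3. restr B (carrier (A i)) = A i))"

section \<open>Indivisibility\<close>

definition indivisibility_witness ::
  "('r, 'a) struct \<Rightarrow> nat \<Rightarrow> ('r, 'a) struct \<Rightarrow> bool" where
  "indivisibility_witness A n B \<longleftrightarrow>
     (\<forall>\<alpha> :: 'a \<Rightarrow> nat. \<alpha> \<in> carrier B \<rightarrow> {..<n + 1} \<longrightarrow>
        (\<exists>A'. substruct A' B \<and> A' \<cong> A \<and> card (\<alpha> ` carrier A') = 1))"

definition indivisible_at :: "('r, 'a) struct set \<Rightarrow> ('r, 'a) struct \<Rightarrow> bool" where
  "indivisible_at K A \<longleftrightarrow> (\<forall>n. \<exists>B\<in>K. indivisibility_witness A n B)"

text \<open>
  The condition is imposed on nonempty \<open>A\<close> only. No class is indivisible at the empty structure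
  (a colouring takes no value there), so imposing it there as well would force \<open>\<beta> 0 n = \<infinity>\<close>,
  hence \<open>\<beta> m n = \<infinity>\<close> for all \<open>m\<close> by monotonicity, for every nonempty hereditary class. Any
  function satisfying the condition for all \<open>A\<close> satisfies the one below.
\<close>

definition indivisibility_bound ::
  "('r, 'a) struct set \<Rightarrow> (nat \<Rightarrow> nat \<Rightarrow> enat) \<Rightarrow> bool" where
  "indivisibility_bound K \<beta> \<longleftrightarrow>
     (\<forall>n. mono (\<lambda>m. \<beta> m n)) \<and>
     (\<forall>A\<in>K. carrier A \<noteq> {} \<longrightarrow> (\<forall>n.
        (\<not> indivisible_at K A \<and> \<beta> (card (carrier A)) n = \<infinity>) \<or>
        (\<exists>B\<in>K. enat (card (carrier B)) \<le> \<beta> (card (carrier A)) n \<and>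
               indivisibility_witness A n B)))"

section \<open>Sunflowers\<close>

definition sunflower :: "'a set set \<Rightarrow> bool" where
  "sunflower Y \<longleftrightarrow> (\<forall>p\<in>Y. finite p) \<and> (\<exists>r. \<forall>p\<in>Y. \<forall>q\<in>Y. p \<noteq> q \<longrightarrow> p \<inter> q = r)"

text \<open>
  The points of \<open>B'\<close> are sets of elements of the universe \<open>'a\<close>. Only finitely many elements
  occur in them, so (lemma \<open>sunflower_witnessD\<close>) the same holds for sets of elements of an
  arbitrary type.
\<close>

definition sunflower_witness ::
  "'r set \<Rightarrow> ('r \<Rightarrow> nat) \<Rightarrow> nat \<Rightarrow> ('r, 'a::infinite) struct \<Rightarrow> ('r, 'a) struct \<Rightarrow> bool" where
  "sunflower_witness L ar n A B \<longleftrightarrow>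
     (\<forall>B' :: ('r, 'a set) struct.
        is_struct L ar B' \<and> B' \<cong> B \<and> (\<forall>p\<in>carrier B'. finite p \<and> card p = n) \<longrightarrow>
        (\<exists>A'. substruct A' B' \<and> A' \<cong> A \<and> sunflower (carrier A')))"

section \<open>The bound\<close>

text \<open>The number of sequences of length at most \<open>k\<close> from an \<open>m\<close>-element set.\<close>

definition seqs_upto :: "enat \<Rightarrow> nat \<Rightarrow> enat" where
  "seqs_upto m k = (case m of enat m' \<Rightarrow> enat (\<Sum>i\<le>k. m' ^ i) | \<infinity> \<Rightarrow> \<infinity>)"

definition extend_bound :: "(nat \<Rightarrow> nat \<Rightarrow> enat) \<Rightarrow> enat \<Rightarrow> nat \<Rightarrow> enat" where
  "extend_bound \<beta> m k = (case m of enat m' \<Rightarrow> \<beta> m' k | \<infinity> \<Rightarrow> \<infinity>)"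

text \<open>
  \<open>sunflower_bound \<beta> a n\<close> is \<open>\<gamma>\<^sub>A(n)\<close> for \<open>|A| = a\<close>; it is specified for \<open>n \<ge> 1\<close> only.
\<close>

fun sunflower_bound :: "(nat \<Rightarrow> nat \<Rightarrow> enat) \<Rightarrow> nat \<Rightarrow> nat \<Rightarrow> enat" where
  "sunflower_bound \<beta> a (Suc 0) = enat a"
| "sunflower_bound \<beta> a (Suc (Suc n)) =
     seqs_upto (extend_bound \<beta> (sunflower_bound \<beta> a (Suc n)) (Suc (Suc n) * a)) a"

section \<open>Independence of the sunflower property from the universe\<close>

lemma iso_sym:
  assumes "A \<cong> B"
  shows "B \<cong> A"
proof -
  obtain f where f: "bij_betw f (carrier A) (carrier B)"
    and r: "\<And>R xs. xs \<in> lists (carrier A) \<Longrightarrow> map f xs \<in> rel B R \<longleftrightarrow> xs \<in> rel A R"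
    using assms unfolding iso_def by blast
  let ?g = "inv_into (carrier A) f"
  have g: "bij_betw ?g (carrier B) (carrier A)"
    using f by (rule bij_betw_inv_into)
  have "map ?g ys \<in> rel A R \<longleftrightarrow> ys \<in> rel B R" if ys: "ys \<in> lists (carrier B)" for R ys
  proof -
    have "map ?g ys \<in> lists (carrier A)"
      using ys g by (auto simp: bij_betw_def in_lists_conv_set)
    moreover have "map f (map ?g ys) = ys"
      using ys f by (auto simp: in_lists_conv_set bij_betw_inv_into_right intro!: map_idI)
    ultimately show ?thesis using r[of "map ?g ys" R] by simp
  qed
  with g show ?thesis unfolding iso_def by blast
qed

lemma iso_trans:
  assumes "A \<cong> B" "B \<cong> C"
  shows "A \<cong> C"
proof -
  obtain f where f: "bij_betw f (carrier A) (carrier B)"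
    and rf: "\<And>R xs. xs \<in> lists (carrier A) \<Longrightarrow> map f xs \<in> rel B R \<longleftrightarrow> xs \<in> rel A R"
    using assms(1) unfolding iso_def by blast
  obtain g where g: "bij_betw g (carrier B) (carrier C)"
    and rg: "\<And>R xs. xs \<in> lists (carrier B) \<Longrightarrow> map g xs \<in> rel C R \<longleftrightarrow> xs \<in> rel B R"
    using assms(2) unfolding iso_def by blast
  have "bij_betw (g \<circ> f) (carrier A) (carrier C)"
    using f g by (rule bij_betw_trans)
  moreover have "map (g \<circ> f) xs \<in> rel C R \<longleftrightarrow> xs \<in> rel A R"
    if xs: "xs \<in> lists (carrier A)" for R xs
  proof -
    have "map f xs \<in> lists (carrier B)"
      using xs f by (auto simp: bij_betw_def in_lists_conv_set)
    then show ?thesis using rg[of "map f xs" R] rf[OF xs, of R] by simp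
  qed
  ultimately show ?thesis unfolding iso_def by blast
qed

definition map_struct :: "('a \<Rightarrow> 'b) \<Rightarrow> ('r, 'a) struct \<Rightarrow> ('r, 'b) struct" where
  "map_struct f A = \<lparr>carrier = f ` carrier A, rel = (\<lambda>R. map f ` rel A R)\<rparr>"

lemma map_struct:
  assumes A: "is_struct L ar A" and inj: "inj_on f (carrier A)"
  shows "is_struct L ar (map_struct f A)" and "A \<cong> map_struct f A"
proof -
  have sub: "rel A R \<subseteq> lists (carrier A)" for R
    using A unfolding is_struct_def by (cases "R \<in> L") auto
  show "is_struct L ar (map_struct f A)"
    unfolding is_struct_def
  proof (intro conjI ballI allI impI)
    fix R assume "R \<in> L"
    then have "rel A R \<subseteq> {xs. length xs = ar R \<and> set xs \<subseteq> carrier A}"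
      using A unfolding is_struct_def by blast
    then show "rel (map_struct f A) R \<subseteq>
        {xs. length xs = ar R \<and> set xs \<subseteq> carrier (map_struct f A)}"
      unfolding map_struct_def by fastforce
  next
    fix R assume "R \<notin> L"
    then show "rel (map_struct f A) R = {}"
      using A unfolding is_struct_def map_struct_def by simp
  qed
  have "map f xs \<in> map f ` rel A R \<longleftrightarrow> xs \<in> rel A R" if xs: "xs \<in> lists (carrier A)" for xs R
  proof
    assume "map f xs \<in> map f ` rel A R"
    then obtain ys where ys: "ys \<in> rel A R" "map f xs = map f ys" by blast
    then have "set xs \<union> set ys \<subseteq> carrier A" using xs sub by blast
    then have "xs = ys" using ys(2) inj map_inj_on[of f xs ys] inj_on_subset by blast
    with ys show "xs \<in> rel A R" by simp
  qed simp
  then show "A \<cong> map_struct f A"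
    using inj unfolding iso_def map_struct_def by (intro exI[of _ f]) (simp add: bij_betw_def)
qed

lemma is_struct_restr: "is_struct L ar A \<Longrightarrow> is_struct L ar (restr A X)"
  unfolding is_struct_def restr_def by auto

lemma sunflower_witnessD:
  fixes A B :: "('r, 'a::infinite) struct" and B' :: "('r, 'c set) struct"
  assumes wit: "sunflower_witness L ar n A B" and fin: "finite (carrier B)"
    and B': "is_struct L ar B'" "B' \<cong> B" "\<And>p. p \<in> carrier B' \<Longrightarrow> finite p \<and> card p = n"
  shows "\<exists>A'. substruct A' B' \<and> A' \<cong> A \<and> sunflower (carrier A')"
proof -
  define U where "U = \<Union>(carrier B')"
  have "finite (carrier B')"
    using B'(2) fin unfolding iso_def using bij_betw_finite by blast
  then have "finite U" unfolding U_def using B'(3) by blast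
  moreover obtain T :: "'a set" where "finite T" "card T = card U"
    using infinite_arbitrarily_large[OF infinite_UNIV] by blast
  ultimately obtain h where "bij_betw h U T"
    using finite_same_card_bij by metis
  then have h: "inj_on h U" by (rule bij_betw_imp_inj_on)
  have sub_U: "p \<subseteq> U" if "p \<in> carrier B'" for p
    using that unfolding U_def by blast
  define g where "g = image h"
  have g: "inj_on g (carrier B')"
    unfolding g_def
    by (intro inj_onI) (metis sub_U inj_on_image_eq_iff[OF h])
  define B'' where "B'' = map_struct g B'"
  have "is_struct L ar B''" "B' \<cong> B''"
    unfolding B''_def using map_struct[OF B'(1) g] by auto
  moreover have "B'' \<cong> B" using \<open>B' \<cong> B''\<close> B'(2) iso_sym iso_trans by blast
  moreover have "finite q \<and> card q = n" if q: "q \<in> carrier B''" for q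
  proof -
    obtain p where p: "p \<in> carrier B'" "q = h ` p"
      using q unfolding B''_def map_struct_def g_def by auto
    then show ?thesis
      using B'(3)[OF p(1)] card_image inj_on_subset[OF h sub_U[OF p(1)]] by auto
  qed
  ultimately obtain A'' where A'': "substruct A'' B''" "A'' \<cong> A" "sunflower (carrier A'')"
    using wit unfolding sunflower_witness_def by blast
  define X where "X = {p \<in> carrier B'. g p \<in> carrier A''}"
  define A' where "A' = restr B' X"
  have carA': "carrier A' = X" unfolding A'_def restr_def X_def by auto
  have X: "X \<subseteq> carrier B'" unfolding X_def by blast
  have sub: "substruct A' B'"
    unfolding substruct_def using carA' X A'_def by simp
  have relB': "rel B' R \<subseteq> lists (carrier B')" for R
    using B'(1) unfolding is_struct_def by (cases "R \<in> L") auto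
  have "map_struct g A' = A''"
  proof -
    have A''_eq: "A'' = restr B'' (carrier A'')" and A''_sub: "carrier A'' \<subseteq> carrier B''"
      using A''(1) unfolding substruct_def by auto
    have "g ` X = carrier A''"
      using A''_sub unfolding X_def B''_def map_struct_def by auto
    moreover have "map g ` (rel B' R \<inter> lists X) = map g ` rel B' R \<inter> lists (carrier A'')" for R
    proof
      show "map g ` (rel B' R \<inter> lists X) \<subseteq> map g ` rel B' R \<inter> lists (carrier A'')"
        unfolding X_def by (auto simp: in_lists_conv_set)
      show "map g ` rel B' R \<inter> lists (carrier A'') \<subseteq> map g ` (rel B' R \<inter> lists X)"
      proof
        fix ys assume "ys \<in> map g ` rel B' R \<inter> lists (carrier A'')"
        then obtain xs where xs: "xs \<in> rel B' R" "ys = map g xs" "map g xs \<in> lists (carrier A'')"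
          by blast
        then have "xs \<in> lists X"
          using relB'[of R] unfolding X_def by (auto simp: in_lists_conv_set)
        with xs show "ys \<in> map g ` (rel B' R \<inter> lists X)" by blast
      qed
    qed
    moreover have "carrier A'' = carrier B'' \<inter> carrier A''" using A''_sub by blast
    ultimately have "map_struct g A' = restr B'' (carrier A'')"
      unfolding A'_def B''_def map_struct_def restr_def
      using X by (auto simp: Int_absorb1 map_struct_def)
    with A''_eq show ?thesis by simp
  qed
  moreover have "is_struct L ar A'" unfolding A'_def using B'(1) by (rule is_struct_restr)
  moreover have gX: "inj_on g X" using g X by (rule inj_on_subset)
  ultimately have "A' \<cong> A''" using map_struct(2)[of L ar A' g] carA' by simp
  then have "A' \<cong> A" using A''(2) by (rule iso_trans)
  moreover have "sunflower (carrier A')"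
  proof -
    obtain r where r: "\<forall>p\<in>carrier A''. \<forall>q\<in>carrier A''. p \<noteq> q \<longrightarrow> p \<inter> q = r"
      using A''(3) unfolding sunflower_def by (elim conjE exE)
    have "p \<inter> q = inv_into U h ` r" if pq: "p \<in> X" "q \<in> X" "p \<noteq> q" for p q
    proof -
      have pU: "p \<subseteq> U" "q \<subseteq> U" using pq X sub_U by blast+
      have "g p \<noteq> g q" using gX pq by (meson inj_onD)
      moreover have "g p \<in> carrier A''" "g q \<in> carrier A''" using pq unfolding X_def by auto
      ultimately have "h ` p \<inter> h ` q = r" using r unfolding g_def by simp
      then have "r = h ` (p \<inter> q)" using inj_on_image_Int[OF h pU] by simp
      moreover have "p \<inter> q \<subseteq> U" using pU by blast
      ultimately show ?thesis using inv_into_image_cancel[OF h] by metis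
    qed
    then have "\<forall>p\<in>X. \<forall>q\<in>X. p \<noteq> q \<longrightarrow> p \<inter> q = inv_into U h ` r" by simp
    moreover have "\<forall>p\<in>X. finite p" using X B'(3) by blast
    ultimately show ?thesis unfolding sunflower_def carA' by (intro conjI exI)
  qed
  ultimately show ?thesis using sub by blast
qed

end

theory Submission
  imports Defs "HOL-Library.Disjoint_Sets"
begin

text \<open>
  The witness for \<open>n + 1\<close> is a tree whose nodes other than the root are the nonempty sequences of
  length at most \<open>|A|\<close> over \<open>D\<close>, where \<open>D\<close> is a witness to indivisibility of a witness \<open>C\<close> for
  \<open>n\<close>: the children of every node form a copy of \<open>D\<close>, and every branch is a copy of \<open>A\<close>. In such
  a tree of sets of size \<open>n + 1\<close>, climb a branch and colour the children \<open>d\<close> of the node reached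
  by an element that \<open>d\<close> shares with the union of the sets chosen so far, or by a default colour
  if there is none. In a monochromatic copy of \<open>C\<close>, either every set is disjoint from the earlier
  ones, and one climbs further, or all sets share an element \<open>x\<close>; removing \<open>x\<close> leaves sets of size
  \<open>n\<close>. A branch of pairwise disjoint sets is a sunflower.

  The tree is built with the 3-disjoint amalgamation property. Indivisibility makes all points of
  \<open>D\<close> realise the same quantifier-free 1-type, so that a single point of \<open>D\<close> can be put on top of
  a partial copy of \<open>A\<close>; the points of \<open>D\<close> are then added one at a time.
\<close>

section \<open>Partial embeddings\<close>

text \<open>Records a partial isomorphism between induced substructures, with the domain
  \<open>X\<close> as an argument of its own so that it can grow point by point. Lists over
  \<open>X\<close> include the empty list, so even \<open>emb {}\<close> is a condition: the nullary
  symbols must agree.\<close>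

definition emb :: "'a set \<Rightarrow> ('a \<Rightarrow> 'b) \<Rightarrow> ('r, 'a) struct \<Rightarrow> ('r, 'b) struct \<Rightarrow> bool" where
  "emb X f A B \<longleftrightarrow> inj_on f X \<and> f ` X \<subseteq> carrier B \<and>
     (\<forall>R. \<forall>xs\<in>lists X. map f xs \<in> rel B R \<longleftrightarrow> xs \<in> rel A R)"

lemma
  assumes "emb X f A B"
  shows emb_inj: "inj_on f X" and emb_image: "f ` X \<subseteq> carrier B"
    and emb_rel: "xs \<in> lists X \<Longrightarrow> map f xs \<in> rel B R \<longleftrightarrow> xs \<in> rel A R"
  using assms unfolding emb_def by blast+

lemma emb_cong:
  assumes "emb X f A B" "\<And>x. x \<in> X \<Longrightarrow> f x = f' x"
  shows "emb X f' A B"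
proof -
  have "map f' xs \<in> rel B R \<longleftrightarrow> map f xs \<in> rel B R" if "xs \<in> lists X" for xs R
  proof -
    have "map f' xs = map f xs" using that assms(2) by (auto simp: in_lists_conv_set)
    then show ?thesis by (rule arg_cong)
  qed
  moreover have "inj_on f' X \<longleftrightarrow> inj_on f X" using assms(2) by (intro inj_on_cong) auto
  moreover have "f' ` X = f ` X" using assms(2) by (intro image_cong) auto
  ultimately show ?thesis using assms(1) unfolding emb_def by simp
qed

lemma emb_subset: "emb X f A B \<Longrightarrow> Y \<subseteq> X \<Longrightarrow> emb Y f A B"
  unfolding emb_def using inj_on_subset[of f X Y] lists_mono[of Y X] image_mono[of Y X f]
  by (meson order_trans subsetD)

lemma emb_comp:
  assumes "emb X f A B" "emb Y h B C" "f ` X \<subseteq> Y"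
  shows "emb X (\<lambda>x. h (f x)) A C"
proof -
  have "inj_on (h \<circ> f) X"
    using emb_inj[OF assms(1)] inj_on_subset[OF emb_inj[OF assms(2)] assms(3)] by (rule comp_inj_on)
  moreover have "map (\<lambda>x. h (f x)) xs \<in> rel C R \<longleftrightarrow> xs \<in> rel A R" if "xs \<in> lists X" for xs R
  proof -
    have "map f xs \<in> lists Y" using that assms(3) by (auto simp: in_lists_conv_set)
    then have "map h (map f xs) \<in> rel C R \<longleftrightarrow> map f xs \<in> rel B R"
      using emb_rel[OF assms(2)] by blast
    then show ?thesis using emb_rel[OF assms(1) that] by (simp add: comp_def)
  qed
  moreover have "(\<lambda>x. h (f x)) ` X \<subseteq> carrier C"
    using emb_image[OF assms(2)] assms(3) by (auto simp: image_subset_iff)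
  ultimately show ?thesis unfolding emb_def by (simp add: comp_def)
qed

lemma emb_incl: "emb X f A B \<Longrightarrow> emb (carrier B) (\<lambda>x. x) B C \<Longrightarrow> emb X f A C"
  using emb_comp[of X f A B "carrier B" "\<lambda>x. x" C] by (auto simp: emb_def)

text \<open>Two partial isomorphisms given by the same map compare their targets on the common
  image. Most overlap conditions of the amalgamations below are checked in this form.\<close>

lemma emb_transport:
  assumes "emb X f A B" "emb X f A C"
  shows "emb (f ` X) (\<lambda>x. x) B C"
proof -
  have "map (\<lambda>x. x) xs \<in> rel C R \<longleftrightarrow> xs \<in> rel B R" if xs: "xs \<in> lists (f ` X)" for xs R
  proof -
    obtain ys where "ys \<in> lists X" "xs = map f ys" using xs by (auto simp: lists_image)
    then show ?thesis using assms unfolding emb_def by simp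
  qed
  then show ?thesis using assms unfolding emb_def by auto
qed

lemma emb_sym: "emb X (\<lambda>x. x) A B \<Longrightarrow> X \<subseteq> carrier A \<Longrightarrow> emb X (\<lambda>x. x) B A"
  unfolding emb_def by simp

lemma emb_refl: "X \<subseteq> carrier A \<Longrightarrow> emb X (\<lambda>x. x) A A"
  unfolding emb_def by simp

lemma emb_inv_into:
  assumes "emb (carrier A) f A B"
  shows "emb (f ` carrier A) (inv_into (carrier A) f) B A"
proof -
  let ?g = "inv_into (carrier A) f"
  have f: "inj_on f (carrier A)" using assms unfolding emb_def by blast
  have "map ?g xs \<in> rel A R \<longleftrightarrow> xs \<in> rel B R" if xs: "xs \<in> lists (f ` carrier A)" for xs R
  proof -
    obtain ys where ys: "ys \<in> lists (carrier A)" "xs = map f ys"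
      using xs by (auto simp: lists_image)
    then have "map ?g xs = ys" using f by (auto simp: in_lists_conv_set intro!: map_idI)
    then show ?thesis using assms ys unfolding emb_def by simp
  qed
  moreover have "?g ` f ` carrier A \<subseteq> carrier A" using f by auto
  moreover have "inj_on ?g (f ` carrier A)" by (rule inj_on_inv_into) simp
  ultimately show ?thesis unfolding emb_def by blast
qed

section \<open>Restrictions, isomorphic copies and fresh points\<close>

lemma rel_subset_lists: "is_struct L ar A \<Longrightarrow> rel A R \<subseteq> lists (carrier A)"
  unfolding is_struct_def by (cases "R \<in> L") auto

lemma carrier_restr [simp]: "carrier (restr A X) = carrier A \<inter> X"
  unfolding restr_def by simp

lemma carrier_map_struct [simp]: "carrier (map_struct f A) = f ` carrier A"
  unfolding map_struct_def by simp

lemma emb_restr: "X \<subseteq> Y \<Longrightarrow> X \<subseteq> carrier A \<Longrightarrow> emb X (\<lambda>x. x) A (restr A Y)"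
  using lists_mono[of X Y] unfolding emb_def restr_def by auto

lemma emb_map_struct:
  assumes "is_struct L ar A" "inj_on f (carrier A)"
  shows "emb (carrier A) f A (map_struct f A)"
proof -
  have "xs \<in> rel A R" if "xs \<in> lists (carrier A)" "map f xs = map f ys" "ys \<in> rel A R" for xs ys R
  proof -
    have "set xs \<union> set ys \<subseteq> carrier A" using rel_subset_lists[OF assms(1)] that by blast
    then have "xs = ys" using that(2) assms(2) map_inj_on inj_on_subset by metis
    then show ?thesis using that by simp
  qed
  then show ?thesis using assms unfolding emb_def map_struct_def by auto
qed

lemma iso_iff_emb: "A \<cong> B \<longleftrightarrow> (\<exists>f. emb (carrier A) f A B \<and> f ` carrier A = carrier B)"
  unfolding iso_def emb_def bij_betw_def by blast

lemma emb_copy: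
  assumes "emb (carrier A) f A B"
  shows "substruct (restr B (f ` carrier A)) B"
    and "restr B (f ` carrier A) \<cong> A"
    and "carrier (restr B (f ` carrier A)) = f ` carrier A"
proof -
  have sub: "f ` carrier A \<subseteq> carrier B" using assms unfolding emb_def by blast
  then show c: "carrier (restr B (f ` carrier A)) = f ` carrier A" by auto
  then show "substruct (restr B (f ` carrier A)) B" using sub unfolding substruct_def by simp
  have "emb (carrier A) f A (restr B (f ` carrier A))"
    using emb_comp[OF assms emb_restr[OF order_refl sub] order_refl] .
  then have "A \<cong> restr B (f ` carrier A)" using c unfolding iso_iff_emb by auto
  then show "restr B (f ` carrier A) \<cong> A" by (rule iso_sym)
qed

lemma substruct_emb:
  assumes "substruct A B"
  shows "emb (carrier A) (\<lambda>x. x) A B"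
proof -
  have "carrier A \<subseteq> carrier B" "restr B (carrier A) = A" using assms unfolding substruct_def by auto
  then show ?thesis
    using emb_sym[OF emb_restr[of "carrier A" "carrier A" B]] by simp
qed

lemma restr_eqI:
  assumes "emb X (\<lambda>x. x) A B" "X \<subseteq> carrier A"
  shows "restr A X = restr B X"
  using assms unfolding emb_def restr_def by (auto simp: Int_absorb1 fun_eq_iff)

lemma iso_substruct_emb:
  assumes "substruct A' B" "A' \<cong> A"
  obtains f where "emb (carrier A) f A B" "f ` carrier A = carrier A'"
proof -
  obtain f where f: "emb (carrier A) f A A'" "f ` carrier A = carrier A'"
    using iso_sym[OF assms(2)] unfolding iso_iff_emb by blast
  then show ?thesis using that emb_incl[OF f(1) substruct_emb[OF assms(1)]] by blast
qed

lemma fresh_injection: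
  fixes V :: "'b::infinite set"
  assumes "finite S" "finite V"
  obtains h where "inj_on h S" "h ` S \<inter> V = {}"
proof -
  have "infinite (UNIV - V)" using assms(2) infinite_UNIV by simp
  then obtain T where T: "finite T" "card T = card S" "T \<subseteq> UNIV - V"
    using infinite_arbitrarily_large by metis
  then obtain h where "bij_betw h S T" using finite_same_card_bij assms(1) by metis
  then show ?thesis using that T(3) unfolding bij_betw_def by blast
qed

section \<open>Indivisibility\<close>

text \<open>A monochromatic copy, read as an embedding. Since its set of colours is a singleton,
  \<open>A\<close> cannot be empty.\<close>

lemma indivisibility_witness_emb:
  assumes "indivisibility_witness A n B" "\<alpha> \<in> carrier B \<rightarrow> {..<n + 1}"
  obtains f c where "emb (carrier A) f A B" "carrier A \<noteq> {}" "\<And>a. a \<in> carrier A \<Longrightarrow> \<alpha> (f a) = c"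
proof -
  obtain A' where A': "substruct A' B" "A' \<cong> A" "card (\<alpha> ` carrier A') = 1"
    using assms unfolding indivisibility_witness_def by blast
  obtain f where f: "emb (carrier A) f A B" "f ` carrier A = carrier A'"
    using iso_substruct_emb[OF A'(1,2)] .
  obtain c where "\<alpha> ` carrier A' = {c}" using A'(3) by (auto simp: card_1_singleton_iff)
  then have "\<alpha> ` f ` carrier A = {c}" using f by simp
  then have "carrier A \<noteq> {}" "\<And>a. a \<in> carrier A \<Longrightarrow> \<alpha> (f a) = c" by auto
  then show ?thesis using that[OF f(1)] by blast
qed

text \<open>Colour a point of a witness according to whether it realises the quantifier-free type of
  \<open>x\<close>. In a monochromatic copy of \<open>A\<close> the image of \<open>x\<close> does,
  hence so does the image of \<open>y\<close>, and the inverse of the copy carries this back to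
  \<open>A\<close>.\<close>

lemma indivisible_at_one_type:
  assumes "indivisible_at K A" "x \<in> carrier A" "y \<in> carrier A"
  shows "emb {x} (\<lambda>_. y) A A"
proof -
  obtain W where W: "indivisibility_witness A 1 W"
    using assms(1) unfolding indivisible_at_def by blast
  define \<alpha> where "\<alpha> w = (if emb {x} (\<lambda>_. w) A W then 0 else 1 :: nat)" for w
  have "\<alpha> \<in> carrier W \<rightarrow> {..<1 + 1}" unfolding \<alpha>_def by auto
  then obtain f c where f: "emb (carrier A) f A W" "\<And>a. a \<in> carrier A \<Longrightarrow> \<alpha> (f a) = c"
    using indivisibility_witness_emb[OF W] by metis
  have "emb {x} (\<lambda>_. f x) A W"
    by (rule emb_cong[OF emb_subset[OF f(1)]]) (use assms in auto)
  then have "\<alpha> (f y) = 0" using f(2)[OF assms(2)] f(2)[OF assms(3)] unfolding \<alpha>_def by simp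
  then have "emb {x} (\<lambda>_. f y) A W" unfolding \<alpha>_def by (auto split: if_splits)
  then have "emb {x} (\<lambda>_. inv_into (carrier A) f (f y)) A A"
    by (rule emb_comp[OF _ emb_inv_into[OF f(1)]]) (use assms in auto)
  moreover have "inv_into (carrier A) f (f y) = y"
    using f(1) assms(3) unfolding emb_def by simp
  ultimately show ?thesis by simp
qed

section \<open>Trees of copies\<close>

text \<open>
  \<open>f\<close> maps the part \<open>X\<close> of \<open>A\<close> to the branch below the current node of \<open>B\<close>, and the list
  contains the points of \<open>A\<close> which are still to be placed on the branch.
\<close>

fun tree_above ::
  "('r, 'a) struct \<Rightarrow> ('r, 'd) struct \<Rightarrow> ('r, 'b) struct \<Rightarrow> ('a \<Rightarrow> 'b) \<Rightarrow> 'a set \<Rightarrow> 'a list \<Rightarrow> bool"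
where
  "tree_above A D B f X [] \<longleftrightarrow> True"
| "tree_above A D B f X (y # ys) \<longleftrightarrow>
     (\<exists>g. emb (carrier D) g D B \<and>
        (\<forall>d\<in>carrier D. emb (insert y X) (f(y := g d)) A B \<and>
           tree_above A D B (f(y := g d)) (insert y X) ys))"

text \<open>An embedding carries all copies of \<open>D\<close> and all branches along. Agreement on
  \<open>X\<close> is enough because every later value of the map is set by the tree itself.\<close>

lemma tree_above_emb:
  assumes "tree_above A D B f X ys" "emb (carrier B) h B C" "\<And>x. x \<in> X \<Longrightarrow> f' x = h (f x)"
  shows "tree_above A D C f' X ys"
  using assms
proof (induction ys arbitrary: f f' X)
  case (Cons y ys)
  obtain g where g: "emb (carrier D) g D B"
    "\<And>d. d \<in> carrier D \<Longrightarrow> emb (insert y X) (f(y := g d)) A B"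
    "\<And>d. d \<in> carrier D \<Longrightarrow> tree_above A D B (f(y := g d)) (insert y X) ys"
    using Cons.prems(1) by auto
  have "emb (carrier D) (\<lambda>d. h (g d)) D C"
    using g(1) Cons.prems(2) by (rule emb_comp) (use g(1) in \<open>auto simp: emb_def\<close>)
  moreover have "emb (insert y X) (f'(y := h (g d))) A C"
    and "tree_above A D C (f'(y := h (g d))) (insert y X) ys" if d: "d \<in> carrier D" for d
  proof -
    have eq: "(f'(y := h (g d))) x = h ((f(y := g d)) x)" if "x \<in> insert y X" for x
      using that Cons.prems(3) by auto
    have "emb (insert y X) (\<lambda>x. h ((f(y := g d)) x)) A C"
      using g(2)[OF d] Cons.prems(2) by (rule emb_comp) (use g(2)[OF d] in \<open>auto simp: emb_def\<close>)
    then show "emb (insert y X) (f'(y := h (g d))) A C" by (rule emb_cong) (rule eq[symmetric])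
    show "tree_above A D C (f'(y := h (g d))) (insert y X) ys"
      using g(3)[OF d] Cons.prems(2) eq by (rule Cons.IH)
  qed
  ultimately show ?case by auto
qed simp

section \<open>Amalgamation and the construction of the tree\<close>

locale amalgamation_age =
  fixes L :: "'r set" and ar :: "'r \<Rightarrow> nat" and K :: "('r, 'a::infinite) struct set"
  assumes age: "age L ar K"
    and hereditary: "hereditary K"
    and amalgamation: "disjoint_amalgamation_3 K"
begin

lemma is_struct: "A \<in> K \<Longrightarrow> is_struct L ar A"
  and finite_carrier: "A \<in> K \<Longrightarrow> finite (carrier A)"
  using age unfolding age_def by auto

lemma map_struct_in: "A \<in> K \<Longrightarrow> inj_on f (carrier A) \<Longrightarrow> map_struct f A \<in> K"
  using age map_struct[OF is_struct] unfolding age_def by blast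

lemma restr_in:
  assumes "A \<in> K"
  shows "restr A X \<in> K"
proof -
  have "restr A X = restr A (carrier A \<inter> X)"
    using rel_subset_lists[OF is_struct[OF assms]] unfolding restr_def by (auto simp: fun_eq_iff)
  then show ?thesis using hereditary assms unfolding hereditary_def by auto
qed

text \<open>By the hereditary property an amalgam can be cut down to the union of the three
  carriers, which keeps its size under control.\<close>

lemma amalgamate_3:
  assumes K: "A \<in> K" "B \<in> K" "C \<in> K"
    and AB: "emb (carrier A \<inter> carrier B) (\<lambda>x. x) A B"
    and AC: "emb (carrier A \<inter> carrier C) (\<lambda>x. x) A C"
    and BC: "emb (carrier B \<inter> carrier C) (\<lambda>x. x) B C"
  obtains E where "E \<in> K" "carrier E = carrier A \<union> carrier B \<union> carrier C"
    "emb (carrier A) (\<lambda>x. x) A E" "emb (carrier B) (\<lambda>x. x) B E" "emb (carrier C) (\<lambda>x. x) C E"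
proof -
  define S where "S i = (if i = 0 then A else if i = 1 then B else C)" for i :: nat
  have less3: "i < 3 \<longleftrightarrow> i = 0 \<or> i = 1 \<or> i = 2" for i :: nat by auto
  have eqs: "restr A (carrier A \<inter> carrier B) = restr B (carrier A \<inter> carrier B)"
    "restr A (carrier A \<inter> carrier C) = restr C (carrier A \<inter> carrier C)"
    "restr B (carrier B \<inter> carrier C) = restr C (carrier B \<inter> carrier C)"
    using restr_eqI[OF AB Int_lower1] restr_eqI[OF AC Int_lower1] restr_eqI[OF BC Int_lower1] .
  have "\<forall>i<3. S i \<in> K" using K unfolding less3 S_def by auto
  moreover have "\<forall>i<3. \<forall>j<3. restr (S i) (carrier (S i) \<inter> carrier (S j)) =
      restr (S j) (carrier (S i) \<inter> carrier (S j))"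
    using eqs unfolding less3 S_def by (auto simp: Int_commute)
  ultimately obtain G where G: "G \<in> K" "\<And>i. i < 3 \<Longrightarrow> restr G (carrier (S i)) = S i"
    using amalgamation unfolding disjoint_amalgamation_3_def by blast
  define U where "U = carrier A \<union> carrier B \<union> carrier C"
  have sub: "carrier Q \<subseteq> carrier G" "emb (carrier Q) (\<lambda>x. x) Q (restr G U)"
    if eq: "restr G (carrier Q) = Q" and "carrier Q \<subseteq> U" for Q
  proof -
    have "carrier G \<inter> carrier Q = carrier Q" using arg_cong[OF eq, of carrier] by simp
    then show c: "carrier Q \<subseteq> carrier G" by blast
    have "substruct Q G" using eq c unfolding substruct_def by simp
    from emb_comp[OF substruct_emb[OF this] emb_restr[of "carrier Q" U G]]
    show "emb (carrier Q) (\<lambda>x. x) Q (restr G U)" using c that by simp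
  qed
  have "restr G (carrier A) = A" "restr G (carrier B) = B" "restr G (carrier C) = C"
    using G(2)[of 0] G(2)[of 1] G(2)[of 2] unfolding S_def by auto
  note embs = sub[OF this(1)] sub[OF this(2)] sub[OF this(3)]
  have subU: "carrier A \<subseteq> U" "carrier B \<subseteq> U" "carrier C \<subseteq> U" unfolding U_def by auto
  have "U \<subseteq> carrier G" unfolding U_def using embs(1)[OF subU(1)] embs(3)[OF subU(2)]
      embs(5)[OF subU(3)] by blast
  then have "carrier (restr G U) = carrier A \<union> carrier B \<union> carrier C" unfolding U_def by auto
  from that[OF restr_in[OF G(1)] this embs(2)[OF subU(1)] embs(4)[OF subU(2)] embs(6)[OF subU(3)]]
  show ?thesis .
qed

text \<open>Moving the points of \<open>B\<close> outside \<open>Z\<close> to fresh elements makes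
  the image of \<open>Z\<close> the exact overlap with \<open>A\<close>. The amalgamation of three
  structures then applies with the moved copy of \<open>B\<close> taken twice.\<close>

lemma amalgamate_2:
  assumes K: "A \<in> K" "B \<in> K" and Z: "Z \<subseteq> carrier B" "emb Z e B A"
  obtains E h where "E \<in> K" "emb (carrier A) (\<lambda>x. x) A E" "emb (carrier B) h B E"
    "\<And>z. z \<in> Z \<Longrightarrow> h z = e z" "card (carrier E) \<le> card (carrier A) + card (carrier B - Z)"
proof -
  obtain k where k: "inj_on k (carrier B - Z)" "k ` (carrier B - Z) \<inter> carrier A = {}"
    using fresh_injection[OF finite_Diff[OF finite_carrier[OF K(2)]] finite_carrier[OF K(1)]] .
  define h where "h x = (if x \<in> Z then e x else k x)" for x
  have eZ: "inj_on e Z" "e ` Z \<subseteq> carrier A" using Z unfolding emb_def by auto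
  have hZ: "h ` Z = e ` Z" unfolding h_def by (intro image_cong) auto
  have hB: "h ` carrier B = e ` Z \<union> k ` (carrier B - Z)"
  proof -
    have "h ` (carrier B - Z) = k ` (carrier B - Z)" unfolding h_def by (intro image_cong) auto
    moreover have "carrier B = Z \<union> (carrier B - Z)" using Z(1) by blast
    ultimately show ?thesis using hZ image_Un by metis
  qed
  have h: "inj_on h (carrier B)"
  proof (rule inj_onI)
    fix x y assume xy: "x \<in> carrier B" "y \<in> carrier B" "h x = h y"
    have "e z \<noteq> k w" if "z \<in> Z" "w \<in> carrier B - Z" for z w
      using that k(2) eZ(2) by blast
    then show "x = y"
      using xy inj_onD[OF k(1)] inj_onD[OF eZ(1)] unfolding h_def by (metis DiffI)
  qed
  define B' where "B' = map_struct h B"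
  have B': "B' \<in> K" "emb (carrier B) h B B'"
    unfolding B'_def using map_struct_in[OF K(2) h] emb_map_struct[OF is_struct[OF K(2)] h] .
  have inter: "carrier A \<inter> carrier B' = h ` Z"
    unfolding B'_def carrier_map_struct hB hZ using k(2) eZ(2) by blast
  have "emb Z h B A" by (rule emb_cong[OF Z(2)]) (simp add: h_def)
  from emb_transport[OF this emb_subset[OF B'(2) Z(1)]]
  have AB': "emb (carrier A \<inter> carrier B') (\<lambda>x. x) A B'" using inter by simp
  obtain E where E: "E \<in> K" "carrier E = carrier A \<union> carrier B' \<union> carrier B'"
    "emb (carrier A) (\<lambda>x. x) A E" "emb (carrier B') (\<lambda>x. x) B' E"
    using amalgamate_3[OF K(1) B'(1) B'(1) AB' AB' emb_refl] by auto
  have "carrier E \<subseteq> carrier A \<union> k ` (carrier B - Z)"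
    unfolding E(2) B'_def carrier_map_struct hB using eZ(2) by blast
  then have "card (carrier E) \<le> card (carrier A \<union> k ` (carrier B - Z))"
    using K finite_carrier by (intro card_mono) auto
  also have "\<dots> \<le> card (carrier A) + card (k ` (carrier B - Z))" by (rule card_Un_le)
  also have "card (k ` (carrier B - Z)) = card (carrier B - Z)" using k(1) by (rule card_image)
  finally have "card (carrier E) \<le> card (carrier A) + card (carrier B - Z)" .
  moreover have "emb (carrier B) h B E" using B'(2) E(4) by (rule emb_incl)
  ultimately show ?thesis using that E(1,3) unfolding h_def by simp
qed

text \<open>The points of a copy of \<open>D\<close> are put over \<open>P\<close> one at a time.
  With \<open>F\<close> already added, a new point \<open>d\<close> is governed by three structures:
  \<open>E\<close> on the points of \<open>P\<close> and \<open>F\<close>, \<open>D2\<close> on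
  \<open>F\<close> and \<open>d\<close>, and \<open>Q\<close> on the points of \<open>P\<close> and
  \<open>d\<close>. They meet pairwise in \<open>F\<close>, in the points of \<open>P\<close> and in
  \<open>d\<close> alone, so an amalgam respects both the copy of \<open>D\<close> and every
  branch.\<close>

lemma amalgamate_children:
  assumes K: "A \<in> K" "P \<in> K" "D \<in> K"
    and X: "X \<subseteq> carrier A" "y \<in> carrier A" "y \<notin> X"
    and f: "emb X f A P" "f ` X = carrier P"
    and D: "carrier D \<noteq> {}" "\<And>d. d \<in> carrier D \<Longrightarrow> emb {y} (\<lambda>_. d) A D"
  obtains E g where "E \<in> K" "emb (carrier P) (\<lambda>x. x) P E" "emb (carrier D) g D E"
    "\<And>d. d \<in> carrier D \<Longrightarrow> emb (insert y X) (f(y := g d)) A E"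
    "card (carrier E) \<le> card (carrier P) + card (carrier D)"
proof -
  obtain g where g: "inj_on g (carrier D)" "g ` carrier D \<inter> carrier P = {}"
    using fresh_injection[OF finite_carrier[OF K(3)] finite_carrier[OF K(2)]] .
  define D1 where "D1 = map_struct g D"
  have D1: "D1 \<in> K" "emb (carrier D) g D D1"
    unfolding D1_def using map_struct_in[OF K(3) g(1)] emb_map_struct[OF is_struct[OF K(3)] g(1)] .
  have carD1: "carrier D1 = g ` carrier D" unfolding D1_def by simp
  have y: "emb {y} (\<lambda>_. d) A D1" if d: "d \<in> carrier D1" for d
  proof -
    obtain d' where d': "d' \<in> carrier D" "d = g d'" using d carD1 by auto
    show ?thesis using emb_comp[OF D(2)[OF d'(1)] D1(2)] d' by simp
  qed
  obtain d0 where d0: "d0 \<in> carrier D1" using D(1) carD1 by auto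
  have "\<exists>E\<in>K. carrier E = carrier P \<union> F \<and> emb (carrier P) (\<lambda>x. x) P E \<and> emb F (\<lambda>x. x) D1 E \<and>
      (\<forall>d\<in>F. emb (insert y X) (f(y := d)) A E)" if "finite F" "F \<subseteq> carrier D1" for F
    using that
  proof (induction F rule: finite_induct)
    case empty
    \<comment> \<open>With no child added only nullary symbols are at stake. \<open>D1\<close> and
      \<open>P\<close> agree on them because each agrees with \<open>A\<close>, in the case of
      \<open>D1\<close> by way of the point \<open>d0\<close>.\<close>
    have "emb {} (\<lambda>x. x) D1 P"
      using emb_transport[of "{}" f A D1 P] emb_cong[OF emb_subset[OF y[OF d0]], of "{}" f]
        emb_subset[OF f(1), of "{}"] by simp
    then show ?case using K(2) by (intro bexI[of _ P]) (auto intro: emb_refl)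
  next
    case (insert d F)
    then obtain E where E: "E \<in> K" "carrier E = carrier P \<union> F" "emb (carrier P) (\<lambda>x. x) P E"
      "emb F (\<lambda>x. x) D1 E" "\<And>c. c \<in> F \<Longrightarrow> emb (insert y X) (f(y := c)) A E"
      by blast
    have d: "d \<in> carrier D1" "d \<notin> carrier P" "F \<inter> carrier P = {}" "F \<subseteq> carrier D1"
      using insert.prems g(2) carD1 by auto
    define D2 where "D2 = restr D1 (insert d F)"
    have D2: "D2 \<in> K" "carrier D2 = insert d F"
      unfolding D2_def using restr_in[OF D1(1)] d by auto
    have D12: "emb (insert d F) (\<lambda>x. x) D1 D2"
      unfolding D2_def using d by (intro emb_restr) auto
    define u where "u = f(y := d)"
    have uX: "u x = f x" if "x \<in> X" for x using that X(3) unfolding u_def by auto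
    have uX': "u ` X = carrier P" unfolding f(2)[symmetric] using uX by (intro image_cong) auto
    have uy: "u y = d" unfolding u_def by simp
    have inj: "inj_on u (insert y X)"
    proof -
      have "inj_on u X" using emb_inj[OF f(1)] inj_on_cong[of X u f] uX by blast
      moreover have "u y \<notin> u ` (X - {y})" using d(2) uX' uy by auto
      ultimately show ?thesis by simp
    qed
    \<comment> \<open>The branch extended by \<open>d\<close>: the part of \<open>A\<close> on
      \<open>insert y X\<close>, moved so that \<open>y\<close> lands on \<open>d\<close>.\<close>
    define Q where "Q = map_struct u (restr A (insert y X))"
    have carAy: "carrier (restr A (insert y X)) = insert y X" using X by auto
    have Q: "Q \<in> K" "carrier Q = insert d (carrier P)"
      unfolding Q_def using map_struct_in[OF restr_in[OF K(1)]] carAy inj uX' uy by auto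
    have "emb (insert y X) u (restr A (insert y X)) Q"
      using emb_map_struct[OF is_struct[OF restr_in[OF K(1)]], of u "insert y X"] inj
      unfolding carAy Q_def by blast
    from emb_comp[OF emb_restr[of "insert y X" "insert y X" A] this]
    have AQ: "emb (insert y X) u A Q" using X by simp
    have ED: "emb (carrier E \<inter> carrier D2) (\<lambda>x. x) E D2"
    proof -
      have "carrier E \<inter> carrier D2 = F" using E(2) D2(2) d insert.hyps by auto
      moreover have "emb F (\<lambda>x. x) E D1" using E(4) d(4) by (rule emb_sym)
      ultimately show ?thesis using emb_comp[OF _ D12, of F "\<lambda>x. x" E] by (simp add: subset_insertI)
    qed
    have EQ: "emb (carrier E \<inter> carrier Q) (\<lambda>x. x) E Q"
    proof -
      have "carrier E \<inter> carrier Q = u ` X" using E(2) Q(2) uX' d insert.hyps by auto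
      moreover have "emb X u A E"
        by (rule emb_cong[OF emb_incl[OF f(1) E(3)]]) (rule uX[symmetric])
      moreover have "emb X u A Q" using AQ by (rule emb_subset) auto
      ultimately show ?thesis using emb_transport[of X u A E Q] by simp
    qed
    \<comment> \<open>Only \<open>d\<close> is shared, so it is enough that \<open>y\<close> has the
      same 1-type as the points of \<open>D\<close>.\<close>
    have DQ: "emb (carrier D2 \<inter> carrier Q) (\<lambda>x. x) D2 Q"
    proof -
      have "carrier D2 \<inter> carrier Q = u ` {y}" using D2(2) Q(2) uy d by auto
      moreover have "emb {y} u A D2"
        by (rule emb_cong[OF emb_comp[OF y[OF d(1)] D12]]) (auto simp: uy)
      moreover have "emb {y} u A Q" using AQ by (rule emb_subset) auto
      ultimately show ?thesis using emb_transport[of "{y}" u A D2 Q] by simp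
    qed
    obtain G where G: "G \<in> K" "carrier G = carrier E \<union> carrier D2 \<union> carrier Q"
      "emb (carrier E) (\<lambda>x. x) E G" "emb (carrier D2) (\<lambda>x. x) D2 G" "emb (carrier Q) (\<lambda>x. x) Q G"
      using amalgamate_3[OF E(1) D2(1) Q(1) ED EQ DQ] .
    have "emb (carrier P) (\<lambda>x. x) P G" using E(3) G(3) by (rule emb_incl)
    moreover have "emb (insert d F) (\<lambda>x. x) D1 G" using D12 G(4) by (rule emb_incl)
    moreover have "emb (insert y X) (f(y := c)) A G" if "c \<in> insert d F" for c
      using that emb_incl[OF E(5) G(3)] emb_incl[OF AQ G(5)] unfolding u_def by auto
    moreover have "carrier G = carrier P \<union> insert d F" using G(2) E(2) D2(2) Q(2) by auto
    ultimately show ?case using G(1) by blast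
  qed
  from this[of "carrier D1"] obtain E where E: "E \<in> K" "carrier E = carrier P \<union> carrier D1"
    "emb (carrier P) (\<lambda>x. x) P E" "emb (carrier D1) (\<lambda>x. x) D1 E"
    "\<And>d. d \<in> carrier D1 \<Longrightarrow> emb (insert y X) (f(y := d)) A E"
    using finite_carrier[OF D1(1)] by blast
  have "emb (carrier D) g D E" using D1(2) E(4) by (rule emb_incl)
  moreover have "card (carrier E) \<le> card (carrier P) + card (carrier D)"
    unfolding E(2) carD1 using card_Un_le[of "carrier P" "g ` carrier D"] card_image[OF g(1)] by simp
  ultimately show ?thesis using that[OF E(1,3)] E(5) carD1 by auto
qed

text \<open>Put a copy of \<open>D\<close> above the current branch, build a tree above each child
  by induction, and glue these trees on along their branches. Each summand of the bound counts the
  sequences of length \<open>Suc i\<close> over \<open>D\<close>, that is, the nodes of one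
  level.\<close>

lemma tree_exists:
  assumes "A \<in> K" "D \<in> K" "carrier D \<noteq> {}"
    and "\<And>a d. a \<in> carrier A \<Longrightarrow> d \<in> carrier D \<Longrightarrow> emb {a} (\<lambda>_. d) A D"
    and "P \<in> K" "emb X f A P" "f ` X = carrier P" "X \<subseteq> carrier A"
    and "set ys \<subseteq> carrier A - X" "distinct ys"
  shows "\<exists>B\<in>K. emb (carrier P) (\<lambda>x. x) P B \<and> tree_above A D B f X ys \<and>
    card (carrier B) \<le> card (carrier P) + (\<Sum>i<length ys. card (carrier D) ^ Suc i)"
  using assms(5-)
proof (induction ys arbitrary: P X f)
  case Nil
  then show ?case by (intro bexI[of _ P]) (auto intro: emb_refl)
next
  case (Cons y ys)
  note A = assms(1) and D = assms(2,3) and one_type = assms(4)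
  have y: "y \<in> carrier A" "y \<notin> X" using Cons.prems by auto
  obtain E g where E: "E \<in> K" "emb (carrier P) (\<lambda>x. x) P E" "emb (carrier D) g D E"
    "\<And>d. d \<in> carrier D \<Longrightarrow> emb (insert y X) (f(y := g d)) A E"
    "card (carrier E) \<le> card (carrier P) + card (carrier D)"
    using amalgamate_children[OF A Cons.prems(1) D(1) Cons.prems(4) y Cons.prems(2,3) D(2)
      one_type[OF y(1)]] by blast
  define m where "m = card (carrier D)"
  define S where "S = (\<Sum>i<length ys. m ^ Suc i)"
  \<comment> \<open>\<open>F\<close> is the set of children whose subtrees have been attached; each
    subtree costs at most \<open>S\<close> new points.\<close>
  have "\<exists>B\<in>K. emb (carrier E) (\<lambda>x. x) E B \<and>
      (\<forall>d\<in>F. tree_above A D B (f(y := g d)) (insert y X) ys) \<and>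
      card (carrier B) \<le> card (carrier E) + card F * S" if "finite F" "F \<subseteq> carrier D" for F
    using that
  proof (induction F rule: finite_induct)
    case empty
    then show ?case using E(1) by (intro bexI[of _ E]) (auto intro: emb_refl)
  next
    case (insert d F)
    then obtain B where B: "B \<in> K" "emb (carrier E) (\<lambda>x. x) E B"
      "\<And>c. c \<in> F \<Longrightarrow> tree_above A D B (f(y := g c)) (insert y X) ys"
      "card (carrier B) \<le> card (carrier E) + card F * S"
      by blast
    have d: "d \<in> carrier D" using insert.prems by auto
    define u where "u = f(y := g d)"
    \<comment> \<open>The branch ending in the child \<open>g d\<close>. The induction hypothesis
      grows a tree \<open>T\<close> over this branch alone, apart from the rest of
      \<open>E\<close>.\<close>
    define P' where "P' = restr E (u ` insert y X)"
    have u: "emb (insert y X) u A E" using E(4)[OF d] unfolding u_def .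
    then have sub: "u ` insert y X \<subseteq> carrier E" unfolding emb_def by blast
    then have carP': "u ` insert y X = carrier P'" unfolding P'_def by auto
    have EP': "emb (carrier P') (\<lambda>x. x) E P'"
      unfolding carP'[symmetric] unfolding P'_def using sub by (intro emb_restr) auto
    have uP': "emb (insert y X) u A P'" using emb_comp[OF u EP' eq_refl[OF carP']] .
    have "P' \<in> K" unfolding P'_def using restr_in[OF E(1)] .
    moreover have "insert y X \<subseteq> carrier A" "set ys \<subseteq> carrier A - insert y X" "distinct ys"
      using Cons.prems by auto
    ultimately obtain T where T: "T \<in> K" "emb (carrier P') (\<lambda>x. x) P' T"
      "tree_above A D T u (insert y X) ys" "card (carrier T) \<le> card (carrier P') + S"
      using Cons.IH[OF _ uP' carP'] unfolding S_def m_def by blast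
    have sub': "carrier P' \<subseteq> carrier T" using T(2) unfolding emb_def by auto
    have "carrier P' \<subseteq> carrier E" using sub unfolding carP' .
    then have "emb (carrier P') (\<lambda>x. x) P' B"
      using emb_incl[OF emb_sym[OF EP'] B(2)] by blast
    then have "emb (carrier P') (\<lambda>x. x) T B"
      using emb_transport[OF T(2)] by simp
    \<comment> \<open>\<open>T\<close> is glued to the structure built so far along
      \<open>P'\<close>; since \<open>h\<close> fixes the branch, the tree stays above the same
      child.\<close>
    then obtain G h where G: "G \<in> K" "emb (carrier B) (\<lambda>x. x) B G" "emb (carrier T) h T G"
      "\<And>z. z \<in> carrier P' \<Longrightarrow> h z = z"
      "card (carrier G) \<le> card (carrier B) + card (carrier T - carrier P')"
      using amalgamate_2[OF B(1) T(1) sub'] by metis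
    have "card (carrier T - carrier P') \<le> S"
      using T(4) sub' finite_carrier[OF T(1)] by (simp add: card_Diff_subset finite_subset)
    then have "card (carrier G) \<le> card (carrier E) + card (insert d F) * S"
      using G(5) B(4) insert.hyps by simp
    moreover have "emb (carrier E) (\<lambda>x. x) E G" using B(2) G(2) by (rule emb_incl)
    moreover have "u z = h (u z)" if "z \<in> insert y X" for z
      using G(4)[OF imageI[OF that, of u, unfolded carP']] by simp
    then have "tree_above A D G u (insert y X) ys" by (rule tree_above_emb[OF T(3) G(3)])
    then have "tree_above A D G (f(y := g c)) (insert y X) ys" if "c \<in> insert d F" for c
      using that tree_above_emb[OF B(3) G(2)] unfolding u_def by auto
    ultimately show ?case using G(1) by blast
  qed
  from this[of "carrier D"] obtain B where B: "B \<in> K" "emb (carrier E) (\<lambda>x. x) E B"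
    "\<And>d. d \<in> carrier D \<Longrightarrow> tree_above A D B (f(y := g d)) (insert y X) ys"
    "card (carrier B) \<le> card (carrier E) + m * S"
    using finite_carrier[OF D(1)] unfolding m_def by blast
  \<comment> \<open>There are \<open>m\<close> children, with at most \<open>S\<close> points above
    each.\<close>
  have "(\<Sum>i<length (y # ys). m ^ Suc i) = m + m * S"
    unfolding S_def by (simp add: sum.lessThan_Suc_shift sum_distrib_left del: sum.lessThan_Suc)
  then have "card (carrier B) \<le> card (carrier P) + (\<Sum>i<length (y # ys). m ^ Suc i)"
    using B(4) E(5) unfolding m_def by linarith
  moreover have "tree_above A D B f X (y # ys)"
    using emb_incl[OF E(3) B(2)] emb_incl[OF E(4) B(2)] B(3) by auto
  moreover have "emb (carrier P) (\<lambda>x. x) P B" using E(2) B(2) by (rule emb_incl)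
  ultimately show ?case using B(1) unfolding m_def by blast
qed

end

section \<open>Sunflowers in trees\<close>

text \<open>Removing \<open>x\<close> from every set keeps distinct sets distinct, because
  \<open>x\<close> can be put back, and lowers their size to \<open>n\<close>, where the witness
  \<open>C\<close> applies. Putting \<open>x\<close> back enlarges the kernel of the sunflower by
  \<open>x\<close>.\<close>

lemma common_element_sunflower:
  fixes B :: "('r, 'c set) struct" and C :: "('r, 'a::infinite) struct"
  assumes wit: "sunflower_witness L ar n A C"
    and C: "is_struct L ar C" "finite (carrier C)" "emb (carrier C) k C B"
    and sz: "\<And>p. p \<in> carrier B \<Longrightarrow> finite p \<and> card p = Suc n"
    and x: "\<And>c. c \<in> carrier C \<Longrightarrow> x \<in> k c"
  shows "\<exists>A'. substruct A' B \<and> A' \<cong> A \<and> sunflower (carrier A')"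
proof -
  have kB: "k c \<in> carrier B" if "c \<in> carrier C" for c using C(3) that unfolding emb_def by auto
  define k' where "k' c = k c - {x}" for c
  have ins: "insert x (k' c) = k c" if "c \<in> carrier C" for c
    using x[OF that] unfolding k'_def by auto
  have inj: "inj_on k' (carrier C)"
    using C(3) ins unfolding emb_def inj_on_def by metis
  define B' where "B' = map_struct k' C"
  have B': "is_struct L ar B'" "C \<cong> B'" unfolding B'_def using map_struct[OF C(1) inj] .
  have "finite p \<and> card p = n" if p: "p \<in> carrier B'" for p
  proof -
    obtain c where c: "c \<in> carrier C" "p = k c - {x}"
      using p unfolding B'_def k'_def by auto
    then show ?thesis using sz[OF kB[OF c(1)]] x[OF c(1)] by simp
  qed
  then obtain A' where A': "substruct A' B'" "A' \<cong> A" "sunflower (carrier A')"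
    using sunflower_witnessD[OF wit C(2) B'(1) iso_sym[OF B'(2)]] by blast
  obtain f where f: "emb (carrier A) f A B'" "f ` carrier A = carrier A'"
    using iso_substruct_emb[OF A'(1,2)] .
  have k': "emb (carrier C) k' C B'"
    unfolding B'_def using emb_map_struct[OF C(1) inj] .
  have carB': "carrier B' = k' ` carrier C" unfolding B'_def by simp
  \<comment> \<open>Going from \<open>B'\<close> back through \<open>C\<close> to \<open>B\<close>
    amounts to inserting \<open>x\<close>.\<close>
  have "emb (k' ` carrier C) (\<lambda>p. k (inv_into (carrier C) k' p)) B' B"
    by (rule emb_comp[OF emb_inv_into[OF k'] C(3)]) (simp add: inj)
  then have "emb (k' ` carrier C) (insert x) B' B"
    by (rule emb_cong) (use ins inj in \<open>metis imageE inv_into_f_f\<close>)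
  from emb_comp[OF f(1) this]
  have h: "emb (carrier A) (\<lambda>a. insert x (f a)) A B"
    using f(1) carB' unfolding emb_def by simp
  have img: "(\<lambda>a. insert x (f a)) ` carrier A = insert x ` carrier A'"
    unfolding f(2)[symmetric] image_image ..
  obtain r where r: "\<And>p q. p \<in> carrier A' \<Longrightarrow> q \<in> carrier A' \<Longrightarrow> p \<noteq> q \<Longrightarrow> p \<inter> q = r"
    and fin: "\<And>p. p \<in> carrier A' \<Longrightarrow> finite p"
    using A'(3) unfolding sunflower_def by metis
  have "sunflower (insert x ` carrier A')"
    unfolding sunflower_def
  proof (intro conjI exI[of _ "insert x r"] ballI impI)
    show "finite p" if "p \<in> insert x ` carrier A'" for p using that fin by auto
    show "p \<inter> q = insert x r"
      if pq: "p \<in> insert x ` carrier A'" "q \<in> insert x ` carrier A'" "p \<noteq> q" for p q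
    proof -
      obtain p' q' where "p' \<in> carrier A'" "p = insert x p'" "q' \<in> carrier A'" "q = insert x q'"
        using pq by auto
      then show ?thesis using r[of p' q'] pq(3) by auto
    qed
  qed
  then show ?thesis using emb_copy[OF h] img by metis
qed

text \<open>Induction along a branch whose sets so far are pairwise disjoint; a completed branch is
  a sunflower with empty kernel. The earlier sets have at most
  \<open>Suc n * card (carrier A)\<close> elements together, which accounts for the order required
  of \<open>D\<close>.\<close>

lemma tree_sunflower:
  fixes B :: "('r, 'c set) struct" and A C D :: "('r, 'a::infinite) struct"
  assumes wit: "sunflower_witness L ar n A C"
    and C: "is_struct L ar C" "finite (carrier C)"
    and D: "indivisibility_witness C (Suc n * card (carrier A)) D"
    and sz: "\<And>p. p \<in> carrier B \<Longrightarrow> finite p \<and> card p = Suc n"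
    and A: "finite (carrier A)"
    and "tree_above A D B f X ys" "emb X f A B" "disjoint_family_on f X"
    and "X \<union> set ys = carrier A" "X \<inter> set ys = {}" "distinct ys"
  shows "\<exists>A'. substruct A' B \<and> A' \<cong> A \<and> sunflower (carrier A')"
  using assms(7-)
proof (induction ys arbitrary: f X)
  case Nil
  then have f: "emb (carrier A) f A B" "disjoint_family_on f (carrier A)" by auto
  have "sunflower (f ` carrier A)"
    unfolding sunflower_def
  proof (intro conjI exI[of _ "{}"] ballI impI)
    show "finite p" if "p \<in> f ` carrier A" for p using that f(1) sz unfolding emb_def by auto
    show "p \<inter> q = {}" if pq: "p \<in> f ` carrier A" "q \<in> f ` carrier A" "p \<noteq> q" for p q
    proof -
      obtain a b where ab: "a \<in> carrier A" "p = f a" "b \<in> carrier A" "q = f b" using pq(1,2) by auto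
      then show ?thesis using disjoint_family_onD[OF f(2), of a b] pq(3) by auto
    qed
  qed
  then show ?case using emb_copy[OF f(1)] by metis
next
  case (Cons y ys)
  obtain g where g: "emb (carrier D) g D B"
    "\<And>d. d \<in> carrier D \<Longrightarrow> emb (insert y X) (f(y := g d)) A B"
    "\<And>d. d \<in> carrier D \<Longrightarrow> tree_above A D B (f(y := g d)) (insert y X) ys"
    using Cons.prems(1) by auto
  define U where "U = \<Union>(f ` X)"
  define N where "N = Suc n * card (carrier A)"
  have X: "finite X" "X \<subseteq> carrier A" using Cons.prems A finite_subset[of X "carrier A"] by auto
  have fX: "finite (f x)" "card (f x) = Suc n" if "x \<in> X" for x
    using that Cons.prems(2) sz unfolding emb_def by auto
  have "finite U" unfolding U_def using X(1) fX by auto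
  have "card U \<le> (\<Sum>x\<in>X. card (f x))" unfolding U_def using X(1) by (rule card_UN_le)
  also have "\<dots> = card X * Suc n" using fX by simp
  also have "\<dots> \<le> N" unfolding N_def using card_mono[OF A X(2)] by (metis mult.commute mult_le_mono2)
  finally have "card U \<le> card {1..N}" by simp
  \<comment> \<open>The numbering starts at 1 and leaves colour 0 for children disjoint from
    \<open>U\<close>; order \<open>N\<close> allows exactly these \<open>N + 1\<close>
    colours.\<close>
  then obtain e where e: "e ` U \<subseteq> {1..N}" "inj_on e U"
    using \<open>finite U\<close> card_le_inj[of U "{1..N}"] by auto
  define s where "s d = (SOME x. x \<in> g d \<inter> U)" for d
  have s: "s d \<in> g d \<inter> U" if "g d \<inter> U \<noteq> {}" for d
    unfolding s_def some_in_eq using that .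
  define \<alpha> where "\<alpha> d = (if g d \<inter> U = {} then 0 else e (s d))" for d
  have es: "e (s d) \<in> {1..N}" if "g d \<inter> U \<noteq> {}" for d using s[OF that] e(1) by auto
  have "\<alpha> d \<in> {..<N + 1}" for d
    using es[of d] unfolding \<alpha>_def by (cases "g d \<inter> U = {}") auto
  then have "\<alpha> \<in> carrier D \<rightarrow> {..<N + 1}" by blast
  then obtain k c where k: "emb (carrier C) k C D" "carrier C \<noteq> {}"
    "\<And>a. a \<in> carrier C \<Longrightarrow> \<alpha> (k a) = c"
    using indivisibility_witness_emb[OF D[folded N_def]] by metis
  obtain a where a: "a \<in> carrier C" using k(2) by auto
  have kD: "k b \<in> carrier D" if "b \<in> carrier C" for b using that k(1) unfolding emb_def by auto
  have zero: "\<alpha> d = 0 \<longleftrightarrow> g d \<inter> U = {}" for d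
    using es[of d] unfolding \<alpha>_def by (cases "g d \<inter> U = {}") auto
  show ?case
  proof (cases "c = 0")
    case True
    \<comment> \<open>Any child in the monochromatic copy of \<open>C\<close> prolongs the branch,
      being disjoint from all earlier sets.\<close>
    define u where "u = f(y := g (k a))"
    have disj: "g (k a) \<inter> f x = {}" if "x \<in> X" for x
      using True k(3)[OF a] zero[of "k a"] that unfolding U_def by auto
    have y: "y \<notin> X" using Cons.prems by auto
    have "disjoint_family_on u (insert y X)"
      using Cons.prems(3) disj y unfolding u_def disjoint_family_on_def
      by (auto simp: Int_commute)
    moreover have "emb (insert y X) u A B" "tree_above A D B u (insert y X) ys"
      unfolding u_def using g(2,3)[OF kD[OF a]] .
    ultimately show ?thesis using Cons.prems by (intro Cons.IH[of u "insert y X"]) auto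
  next
    case False
    \<comment> \<open>Equal nonzero colours mean equal chosen elements, as \<open>e\<close> is
      injective on \<open>U\<close>; hence one element lies in every set of the copy of
      \<open>C\<close>.\<close>
    have "s (k b) = s (k a)" "s (k b) \<in> g (k b)" if b: "b \<in> carrier C" for b
    proof -
      have ne: "g (k b) \<inter> U \<noteq> {}" "g (k a) \<inter> U \<noteq> {}"
        using False k(3)[OF a] k(3)[OF b] zero by metis+
      have "e (s (k b)) = e (s (k a))" using k(3)[OF a] k(3)[OF b] ne unfolding \<alpha>_def by simp
      then show "s (k b) = s (k a)" using s[OF ne(1)] s[OF ne(2)] e(2) by (auto dest: inj_onD)
      show "s (k b) \<in> g (k b)" using s[OF ne(1)] by auto
    qed
    then have x: "s (k a) \<in> g (k b)" if "b \<in> carrier C" for b using that by metis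
    have "emb (carrier C) (\<lambda>b. g (k b)) C B"
      using k(1) g(1) by (rule emb_comp) (use kD in auto)
    then show ?thesis using x by (intro common_element_sunflower[OF wit C _ sz]) auto
  qed
qed

section \<open>Sizes of sunflower witnesses\<close>

text \<open>Two sets form a sunflower with their intersection as kernel, and distinct singletons are
  disjoint. This settles the base case, and also the structures with at most two points, for which
  indivisibility is not assumed.\<close>

lemma sunflower_witness_self:
  fixes A :: "('r, 'a::infinite) struct"
  assumes "card (carrier A) \<le> 2 \<or> n = 1" "finite (carrier A)"
  shows "sunflower_witness L ar n A A"
  unfolding sunflower_witness_def
proof (intro allI impI, elim conjE)
  fix B' :: "('r, 'a set) struct"
  assume B': "B' \<cong> A" "\<forall>p\<in>carrier B'. finite p \<and> card p = n"
  have fin: "finite (carrier B')" "card (carrier B') = card (carrier A)"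
    using B'(1) assms(2) unfolding iso_def by (auto simp: bij_betw_finite bij_betw_same_card)
  have "\<exists>r. \<forall>p\<in>carrier B'. \<forall>q\<in>carrier B'. p \<noteq> q \<longrightarrow> p \<inter> q = r"
  proof (cases "n = 1")
    case True
    then have "p \<inter> q = {}" if "p \<in> carrier B'" "q \<in> carrier B'" "p \<noteq> q" for p q
      using B'(2) that by (force simp: card_1_singleton_iff)
    then show ?thesis by blast
  next
    case False
    then consider "carrier B' = {}" | b where "carrier B' = {b}" | b c where "carrier B' = {b, c}"
      using assms(1) fin card_0_eq card_1_singletonE card_2_iff
      by (metis One_nat_def Suc_1 le_Suc_eq le_zero_eq)
    then show ?thesis
      by cases (auto simp: Int_commute)
  qed
  then have "sunflower (carrier B')" using B'(2) unfolding sunflower_def by auto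
  moreover have "substruct B' B'" if "is_struct L ar B'"
    using rel_subset_lists[OF that] unfolding substruct_def restr_def by (auto simp: Int_absorb2)
  moreover assume "is_struct L ar B'"
  ultimately show "\<exists>A'. substruct A' B' \<and> A' \<cong> A \<and> sunflower (carrier A')" using B'(1) by blast
qed

section \<open>Comparison of sizes with the recursive bound\<close>

lemma seqs_upto_ge:
  assumes "enat m \<le> M"
  shows "enat (\<Sum>i<k. m ^ Suc i) \<le> seqs_upto M k"
proof (cases M)
  case (enat m')
  have "(\<Sum>i<k. m ^ Suc i) \<le> (\<Sum>i<k. m' ^ Suc i)"
    using assms enat by (intro sum_mono power_mono) auto
  \<comment> \<open>The extra term on the right counts the empty sequence, the root of the tree,
    which is not a point of the structure.\<close>
  also have "\<dots> \<le> (\<Sum>i\<le>k. m' ^ i)"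
    unfolding sum.atMost_shift by simp
  finally show ?thesis unfolding seqs_upto_def enat by simp
qed (simp add: seqs_upto_def)

text \<open>Monotonicity in the first coordinate lets the bound on the size of a witness stand in
  for its actual size.\<close>

lemma extend_bound_ge:
  assumes "mono (\<lambda>m. \<beta> m k)" "enat m \<le> M"
  shows "\<beta> m k \<le> extend_bound \<beta> M k"
proof (cases M)
  case (enat m')
  then show ?thesis using monoD[OF assms(1), of m m'] assms(2) unfolding extend_bound_def by simp
qed (simp add: extend_bound_def)

lemma indivisibility_boundE:
  assumes "indivisibility_bound K \<beta>" "A \<in> K" "carrier A \<noteq> {}"
    and "indivisible_at K A \<or> \<beta> (card (carrier A)) n \<noteq> \<infinity>"
  obtains B where "B \<in> K" "enat (card (carrier B)) \<le> \<beta> (card (carrier A)) n"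
    "indivisibility_witness A n B"
proof -
  have "(\<not> indivisible_at K A \<and> \<beta> (card (carrier A)) n = \<infinity>) \<or>
      (\<exists>B\<in>K. enat (card (carrier B)) \<le> \<beta> (card (carrier A)) n \<and> indivisibility_witness A n B)"
    using assms(1-3) unfolding indivisibility_bound_def by simp
  then show ?thesis using assms(4) that by blast
qed

text \<open>A structure with at most two points will serve as its own witness, so its size has to
  fit below the bound. A witness to indivisibility contains a copy of \<open>A\<close>, so
  \<open>\<beta> a k\<close> is at least \<open>a\<close>, and this passes through the
  recursion.\<close>

lemma card_le_sunflower_bound:
  assumes "indivisibility_bound K \<beta>" "A \<in> K" "finite (carrier A)" "card (carrier A) \<le> 2"
    and fin: "\<And>B. B \<in> K \<Longrightarrow> finite (carrier B)"
  shows "enat (card (carrier A)) \<le> sunflower_bound \<beta> (card (carrier A)) (Suc n)"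
proof (cases "carrier A = {}")
  case True
  then show ?thesis by (simp add: zero_enat_def[symmetric])
next
  case False
  define a where "a = card (carrier A)"
  have a: "a = 1 \<or> a = 2"
    using False assms(3,4) unfolding a_def by (auto simp: le_Suc_eq numeral_2_eq_2)
  have one: "enat a \<le> \<beta> a k" for k
  proof (cases "\<beta> a k = \<infinity>")
    case infinite: False
    then obtain B where B: "B \<in> K" "enat (card (carrier B)) \<le> \<beta> a k" "indivisibility_witness A k B"
      using indivisibility_boundE[OF assms(1,2) False] unfolding a_def by metis
    \<comment> \<open>A constant colouring serves to find a copy of \<open>A\<close> inside
      \<open>B\<close>.\<close>
    have "(\<lambda>_. 0) \<in> carrier B \<rightarrow> {..<k + 1}" by simp
    then obtain f where "emb (carrier A) f A B"
      using indivisibility_witness_emb[OF B(3)] by metis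
    then have "card (carrier A) \<le> card (carrier B)"
      using card_inj_on_le[of f "carrier A" "carrier B"] fin[OF B(1)] unfolding emb_def by blast
    then show ?thesis using B(2) unfolding a_def by (meson enat_ord_simps(1) order_trans)
  qed simp
  have mono: "mono (\<lambda>m. \<beta> m k)" for k using assms(1) unfolding indivisibility_bound_def by blast
  have "enat a \<le> sunflower_bound \<beta> a (Suc n)"
  proof (induction n)
    case (Suc n)
    define M where "M = extend_bound \<beta> (sunflower_bound \<beta> a (Suc n)) (Suc (Suc n) * a)"
    have "enat a \<le> M"
      unfolding M_def using order_trans[OF one extend_bound_ge[where \<beta> = \<beta>, OF mono Suc.IH]] .
    then have "enat (\<Sum>i<a. a ^ Suc i) \<le> seqs_upto M a" by (rule seqs_upto_ge)
    \<comment> \<open>The sum is 1 for \<open>a = 1\<close> and 2 + 4 for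
      \<open>a = 2\<close>.\<close>
    moreover have "a \<le> (\<Sum>i<a. a ^ Suc i)" using a by (auto simp: numeral_2_eq_2)
    ultimately have "enat a \<le> seqs_upto M a" by (meson enat_ord_simps(1) order_trans)
    then show ?case unfolding M_def by simp
  qed simp
  then show ?thesis unfolding a_def .
qed

text \<open>The embedding of \<open>A\<close> is carried through the induction so that
  \<open>C\<close> and \<open>D\<close> keep more than two points, which is where indivisibility is
  assumed.\<close>

lemma (in amalgamation_age) sunflower_witness_exists:
  assumes indiv: "\<And>A. A \<in> K \<Longrightarrow> card (carrier A) > 2 \<Longrightarrow> indivisible_at K A"
    and bound: "indivisibility_bound K \<beta>"
    and A: "A \<in> K" "card (carrier A) > 2"
  shows "\<exists>B\<in>K. enat (card (carrier B)) \<le> sunflower_bound \<beta> (card (carrier A)) (Suc n) \<and>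
    sunflower_witness L ar (Suc n) A B \<and> (\<exists>f. emb (carrier A) f A B)"
proof (induction n)
  case 0
  have "sunflower_witness L ar (Suc 0) A A"
    using finite_carrier[OF A(1)] by (intro sunflower_witness_self) auto
  then show ?case using A(1) emb_refl[of "carrier A" A] by (intro bexI[of _ A]) auto
next
  case (Suc n)
  define a where "a = card (carrier A)"
  \<comment> \<open>Bounds the number of elements in the union of \<open>a\<close> sets of size
    \<open>Suc (Suc n)\<close>.\<close>
  define N where "N = Suc (Suc n) * a"
  define M where "M = extend_bound \<beta> (sunflower_bound \<beta> a (Suc n)) N"
  obtain C e where C: "C \<in> K" "enat (card (carrier C)) \<le> sunflower_bound \<beta> a (Suc n)"
    "sunflower_witness L ar (Suc n) A C" "emb (carrier A) e A C"
    using Suc.IH unfolding a_def by blast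
  have large: "card (carrier Q) > 2" if "Q \<in> K" "emb (carrier A) f A Q" for Q f
    using that A(2) card_inj_on_le[of f "carrier A" "carrier Q"] finite_carrier unfolding emb_def
    by fastforce
  have "carrier C \<noteq> {}" using large[OF C(1,4)] by auto
  then obtain D where D: "D \<in> K" "enat (card (carrier D)) \<le> \<beta> (card (carrier C)) N"
    "indivisibility_witness C N D"
    using indivisibility_boundE[OF bound C(1)] indiv[OF C(1) large[OF C(1,4)]] by metis
  have "(\<lambda>_. 0) \<in> carrier D \<rightarrow> {..<N + 1}" by simp
  then obtain k where k: "emb (carrier C) k C D"
    using indivisibility_witness_emb[OF D(3)] by metis
  have AD: "emb (carrier A) (\<lambda>x. k (e x)) A D"
    using C(4) k by (rule emb_comp) (use C(4) in \<open>auto simp: emb_def\<close>)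
  then have D_large: "card (carrier D) > 2" using large[OF D(1)] by blast
  then have D_ne: "carrier D \<noteq> {}" by auto
  \<comment> \<open>\<open>A\<close> embeds in \<open>D\<close> and all points of \<open>D\<close>
    have the same type, so each point of \<open>A\<close> may be placed on any point of
    \<open>D\<close>.\<close>
  have one_type: "emb {x} (\<lambda>_. d) A D" if "x \<in> carrier A" "d \<in> carrier D" for x d
  proof -
    have "k (e x) \<in> carrier D" using AD that unfolding emb_def by auto
    then have "emb {k (e x)} (\<lambda>_. d) D D"
      using indivisible_at_one_type[OF indiv[OF D(1) D_large]] that by blast
    then show ?thesis
      using emb_comp[OF emb_subset[OF AD, of "{x}"], of "{k (e x)}" "\<lambda>_. d" D] that by simp
  qed
  obtain ys where ys: "set ys = carrier A" "distinct ys"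
    using finite_distinct_list[OF finite_carrier[OF A(1)]] by blast
  then have len: "length ys = a" unfolding a_def using distinct_card by metis
  define f0 :: "'a \<Rightarrow> 'a" where "f0 = (\<lambda>x. x)"
  \<comment> \<open>The tree grows from the empty substructure of \<open>A\<close>, with nothing yet
    placed on the branch.\<close>
  define P where "P = restr A {}"
  have P: "P \<in> K" "carrier P = {}" unfolding P_def using restr_in[OF A(1)] by auto
  have f0: "emb {} f0 A P" unfolding P_def f0_def by (rule emb_restr) auto
  have "f0 ` {} = carrier P" "set ys \<subseteq> carrier A - {}" using P ys by auto
  then obtain B where B: "B \<in> K" "emb (carrier P) (\<lambda>x. x) P B" "tree_above A D B f0 {} ys"
    "card (carrier B) \<le> (\<Sum>i<a. card (carrier D) ^ Suc i)"
    using tree_exists[OF A(1) D(1) D_ne one_type P(1) f0 _ empty_subsetI _ ys(2)] P(2) len by auto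
  have mono: "mono (\<lambda>m. \<beta> m N)" using bound unfolding indivisibility_bound_def by blast
  have "enat (card (carrier D)) \<le> M"
    unfolding M_def using order_trans[OF D(2) extend_bound_ge[where \<beta> = \<beta>, OF mono C(2)]] .
  then have "enat (\<Sum>i<a. card (carrier D) ^ Suc i) \<le> seqs_upto M a" by (rule seqs_upto_ge)
  moreover have "enat (card (carrier B)) \<le> enat (\<Sum>i<a. card (carrier D) ^ Suc i)"
    using B(4) by (simp only: enat_ord_simps)
  ultimately have "enat (card (carrier B)) \<le> seqs_upto M a" by (rule order_trans[rotated])
  then have "enat (card (carrier B)) \<le> sunflower_bound \<beta> a (Suc (Suc n))"
    unfolding M_def N_def by simp
  moreover have "sunflower_witness L ar (Suc (Suc n)) A B"
    unfolding sunflower_witness_def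
  proof (intro allI impI, elim conjE)
    fix B' :: "('r, 'a set) struct"
    assume B': "B' \<cong> B" "\<forall>p\<in>carrier B'. finite p \<and> card p = Suc (Suc n)"
    obtain h where h: "emb (carrier B) h B B'"
      using iso_sym[OF B'(1)] unfolding iso_iff_emb by blast
    have tree: "tree_above A D B' (\<lambda>x. h (f0 x)) {} ys" using B(3) h by (rule tree_above_emb) simp
    have "emb {} f0 A B" using emb_incl[OF f0 B(2)] .
    then have "emb {} (\<lambda>x. h (f0 x)) A B'" using h by (rule emb_comp) simp
    then show "\<exists>A'. substruct A' B' \<and> A' \<cong> A \<and> sunflower (carrier A')"
      using B'(2) ys
      by (intro tree_sunflower[OF C(3) is_struct[OF C(1)] finite_carrier[OF C(1)]
            D(3)[unfolded N_def a_def] _ finite_carrier[OF A(1)] tree])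
        (auto simp: disjoint_family_on_def)
  qed
  moreover have "\<exists>f. emb (carrier A) f A B"
  proof -
    \<comment> \<open>The children of the root form a copy of \<open>D\<close>, which contains a
      copy of \<open>A\<close>.\<close>
    obtain y zs where "ys = y # zs" using len A(2) unfolding a_def by (cases ys) auto
    then obtain g where g: "emb (carrier D) g D B" using B(3) by auto
    have "emb (carrier A) (\<lambda>x. g (k (e x))) A B"
      using AD g by (rule emb_comp) (use AD in \<open>auto simp: emb_def\<close>)
    then show ?thesis by blast
  qed
  ultimately show ?case using B(1) unfolding a_def by blast
qed

theorem theorem4p19:
  fixes L :: "'r set" and ar :: "'r \<Rightarrow> nat"
    and K :: "('r, 'a::infinite) struct set"
    and \<beta> :: "nat \<Rightarrow> nat \<Rightarrow> enat"
  assumes "countable L"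
    and "age L ar K"
    and "hereditary K"
    and "disjoint_amalgamation_3 K"
    and "\<And>A. A \<in> K \<Longrightarrow> card (carrier A) > 2 \<Longrightarrow> indivisible_at K A"
    and "indivisibility_bound K \<beta>"
  shows "\<forall>A\<in>K. \<forall>n\<ge>1. \<exists>B\<in>K.
           enat (card (carrier B)) \<le> sunflower_bound \<beta> (card (carrier A)) n \<and>
           sunflower_witness L ar n A B"
proof (intro ballI allI impI)
  interpret amalgamation_age L ar K using assms(2-4) by unfold_locales
  fix A and n :: nat
  assume A: "A \<in> K" and "n \<ge> 1"
  then obtain n' where n: "n = Suc n'" by (cases n) auto
  show "\<exists>B\<in>K. enat (card (carrier B)) \<le> sunflower_bound \<beta> (card (carrier A)) n \<and>
      sunflower_witness L ar n A B"
  \<comment> \<open>Beyond two points the induction on the size of the sets applies; otherwise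
    \<open>A\<close> is its own witness.\<close>
  proof (cases "card (carrier A) > 2")
    case True
    then show ?thesis
      using sunflower_witness_exists[OF assms(5,6) A, of n'] unfolding n by blast
  next
    case False
    then show ?thesis
      using A finite_carrier sunflower_witness_self[of A n]
        card_le_sunflower_bound[OF assms(6) A] unfolding n by (intro bexI[of _ A]) auto
  qed
qed

end
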